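(* Let $H$ be a commutative ring with identity and let $A$ be an ideal of $H$ with $A\subseteq J(H)$, where $J(H)$ is the Jacobson radical of $H$. Then the following statements are equivalent: (1) $A$ is an $r$-ideal of $H$. (2) $A$ is an $(H\setminus M)$-$r$-ideal of $H$ for every maximal ideal $M$ of $H$.
   Context: For $w\in H$, $\mathrm{Ann}(w)=\{y\in H: yw=0\}$. An ideal $A$ of $H$ is an $r$-ideal if for all $w,z\in H$, $wz\in A$ and $\mathrm{Ann}(w)=0$ imply $z\in A$. A multiplicatively closed subset $S$ of $H$ is a subset containing $1$ and closed under products. An ideal $A$ of $H$ is an $S$-$r$-ideal if $A\cap S=\varnothing$ and there exists $s\in S$ such that for all $w,z\in H$, if $wz\in A$ and $\mathrm{Ann}(w)=0$, then $sz\in A$. An $(H\setminus M)$-$r$-ideal is an $S$-$r$-ideal for $S=H\setminus M$. *)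

theory Defs
  imports "HOL-Algebra.Algebra"
begin

definition jacobson_radical :: "('a, 'b) ring_scheme \<Rightarrow> 'a set" where
  "jacobson_radical H = carrier H \<inter> \<Inter>{M. maximalideal M H}"
  (* The carrier is intersected so that the zero ring, which has no maximal ideal,
     is its own Jacobson radical. *)

definition Ann :: "('a, 'b) ring_scheme \<Rightarrow> 'a \<Rightarrow> 'a set" where
  "Ann H w = {y \<in> carrier H. y \<otimes>\<^bsub>H\<^esub> w = \<zero>\<^bsub>H\<^esub>}"

definition r_ideal :: "('a, 'b) ring_scheme \<Rightarrow> 'a set \<Rightarrow> bool" where
  "r_ideal H A \<longleftrightarrow> ideal A H \<and>
     (\<forall>w\<in>carrier H. \<forall>z\<in>carrier H.
        w \<otimes>\<^bsub>H\<^esub> z \<in> A \<and> Ann H w = {\<zero>\<^bsub>H\<^esub>} \<longrightarrow> z \<in> A)"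

(* On a ring, submonoid refers to the multiplicative structure: submonoid S H says that
   S is a subset of the carrier containing the identity and closed under products. *)
definition S_r_ideal :: "('a, 'b) ring_scheme \<Rightarrow> 'a set \<Rightarrow> 'a set \<Rightarrow> bool" where
  "S_r_ideal H S A \<longleftrightarrow> submonoid S H \<and> ideal A H \<and> A \<inter> S = {} \<and>
     (\<exists>s\<in>S. \<forall>w\<in>carrier H. \<forall>z\<in>carrier H.
        w \<otimes>\<^bsub>H\<^esub> z \<in> A \<and> Ann H w = {\<zero>\<^bsub>H\<^esub>} \<longrightarrow> s \<otimes>\<^bsub>H\<^esub> z \<in> A)"

end

theory Submission
  imports Defs
begin

text \<open>
  Let \<open>w z \<in> A\<close> with \<open>w\<close> regular, that is, \<open>Ann w = 0\<close>. An \<open>r\<close>-ideal \<open>A\<close> must then contain \<open>z\<close>;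
  an \<open>S\<close>-\<open>r\<close>-ideal must be disjoint from \<open>S\<close>, but need only contain \<open>s z\<close>, where \<open>s \<in> S\<close> serves
  all \<open>w\<close> and \<open>z\<close>.

  An \<open>r\<close>-ideal is an \<open>S\<close>-\<open>r\<close>-ideal for every multiplicatively closed \<open>S\<close> disjoint from it,
  with \<open>s = 1\<close>. The complement of a maximal ideal \<open>M\<close> is such a set: it is closed under
  products because \<open>M\<close> is prime, and it misses \<open>A\<close> because \<open>A\<close> lies in the Jacobson radical.

  Conversely, the membership \<open>z \<in> A\<close> is a local question: it holds as soon as for every maximal
  ideal \<open>M\<close> some \<open>s \<notin> M\<close> has \<open>s z \<in> A\<close>. This is \<open>mem_ideal_if_locally_mem\<close>: the multipliers
  carrying \<open>z\<close> into \<open>A\<close> form an ideal \<open>(A : z)\<close>, and if it were proper it would lie in some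
  maximal ideal by Zorn's lemma.
\<close>

lemma (in ring) proper_ideal_in_maximalideal:
  assumes "ideal I R" and "I \<noteq> carrier R"
  shows "\<exists>M. maximalideal M R \<and> I \<subseteq> M"
proof -
  \<comment> \<open>Properness is expressed by omitting \<open>\<one>\<close>, a condition that passes to unions of chains.\<close>
  let ?P = "{J. ideal J R \<and> I \<subseteq> J \<and> \<one> \<notin> J}"
  have IP: "I \<in> ?P"
    using assms ideal.one_imp_carrier by blast
  have "\<exists>M\<in>?P. \<forall>J\<in>?P. M \<subseteq> J \<longrightarrow> J = M"
  proof (rule subset_Zorn)
    fix C assume C: "subset.chain ?P C"
    show "\<exists>U\<in>?P. \<forall>J\<in>C. J \<subseteq> U"
    proof (cases "C = {}")
      case True
      then show ?thesis using IP by blast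
    next
      case False
      have "subset.chain {J. ideal J R} C"
        using C by (auto simp: subset_chain_def)
      then have "ideal (\<Union>C) R"
        using chain_Union_is_ideal[of C] False by simp
      moreover have "I \<subseteq> \<Union>C" "\<one> \<notin> \<Union>C"
        using C False unfolding subset_chain_def by blast+
      ultimately show ?thesis by blast
    qed
  qed
  then obtain M where "M \<in> ?P" and max: "\<forall>J\<in>?P. M \<subseteq> J \<longrightarrow> J = M"
    by (elim bexE)
  then have M: "ideal M R" "I \<subseteq> M" "\<one> \<notin> M"
    by simp_all
  have "maximalideal M R"
  proof (rule maximalidealI)
    show "carrier R \<noteq> M" using M(3) by blast
    show "J = M \<or> J = carrier R" if "ideal J R" "M \<subseteq> J" "J \<subseteq> carrier R" for J
    proof (cases "\<one> \<in> J")
      case True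
      then show ?thesis using ideal.one_imp_carrier[OF that(1)] by blast
    next
      case False
      with that M(2) have "J \<in> ?P" by simp
      then show ?thesis using max that(2) by blast
    qed
  qed (rule M(1))
  with M(2) show ?thesis by blast
qed

text \<open>
  Membership in an ideal may be tested after localizing at each maximal ideal: the condition on
  \<open>M\<close> says that \<open>z/1\<close> lies in the extension of \<open>A\<close> to the localization at \<open>M\<close>.
\<close>

lemma (in cring) mem_ideal_if_locally_mem:
  assumes A: "ideal A R" and z: "z \<in> carrier R"
    and loc: "\<And>M. maximalideal M R \<Longrightarrow> \<exists>s\<in>carrier R - M. s \<otimes> z \<in> A"
  shows "z \<in> A"
proof -
  interpret A: ideal A R by fact
  let ?C = "{s \<in> carrier R. z \<otimes> s \<in> A}"
  have "ideal ?C R"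
    using is_cring z by (rule A.helper_max_prime)
  moreover have "\<not> ?C \<subseteq> M" if "maximalideal M R" for M
    using loc[OF that] z m_comm by fastforce
  ultimately have "?C = carrier R"
    using proper_ideal_in_maximalideal by blast
  then have "z \<otimes> \<one> \<in> A" by blast
  then show ?thesis using z by simp
qed

lemma (in primeideal) submonoid_complement: "submonoid (carrier R - I) R"
proof
  show "\<one> \<in> carrier R - I"
    using I_notcarr one_imp_carrier by blast
qed (use I_prime in blast)+

lemma r_ideal_imp_S_r_ideal:
  assumes "cring H" and S: "submonoid S H" and "A \<inter> S = {}" and r: "r_ideal H A"
  shows "S_r_ideal H S A"
proof -
  interpret cring H by fact
  have "\<one>\<^bsub>H\<^esub> \<in> S" using S by (rule submonoid.one_closed)
  moreover have "\<one>\<^bsub>H\<^esub> \<otimes>\<^bsub>H\<^esub> z \<in> A"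
    if "w \<in> carrier H" "z \<in> carrier H" "w \<otimes>\<^bsub>H\<^esub> z \<in> A \<and> Ann H w = {\<zero>\<^bsub>H\<^esub>}" for w z
  proof -
    have "z \<in> A" using r that unfolding r_ideal_def by blast
    with that(2) show ?thesis by simp
  qed
  ultimately show ?thesis
    using S \<open>A \<inter> S = {}\<close> r unfolding S_r_ideal_def r_ideal_def by blast
qed

theorem proposition2p6:
  fixes H :: "('a, 'b) ring_scheme" and A :: "'a set"
  assumes "cring H"
    and "ideal A H"
    and "A \<subseteq> jacobson_radical H"
  shows "r_ideal H A \<longleftrightarrow> (\<forall>M. maximalideal M H \<longrightarrow> S_r_ideal H (carrier H - M) A)"
proof -
  interpret cring H by fact
  show ?thesis
  proof (intro iffI allI impI)
    fix M assume r: "r_ideal H A" and M: "maximalideal M H"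
    have "submonoid (carrier H - M) H"
      using maximalideal_prime[OF M] by (rule primeideal.submonoid_complement)
    moreover have "A \<inter> (carrier H - M) = {}"
      using assms(3) M by (auto simp: jacobson_radical_def)
    ultimately show "S_r_ideal H (carrier H - M) A"
      using r by (rule r_ideal_imp_S_r_ideal[OF assms(1)])
  next
    assume S: "\<forall>M. maximalideal M H \<longrightarrow> S_r_ideal H (carrier H - M) A"
    have "z \<in> A"
      if w: "w \<in> carrier H" and z: "z \<in> carrier H"
        and wz: "w \<otimes>\<^bsub>H\<^esub> z \<in> A" and Ann: "Ann H w = {\<zero>\<^bsub>H\<^esub>}" for w z
    proof (rule mem_ideal_if_locally_mem[OF assms(2) z])
      fix M assume "maximalideal M H"
      then have "S_r_ideal H (carrier H - M) A" using S by blast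
      then show "\<exists>s\<in>carrier H - M. s \<otimes>\<^bsub>H\<^esub> z \<in> A"
        using w z wz Ann unfolding S_r_ideal_def by blast
    qed
    then show "r_ideal H A"
      using assms(2) unfolding r_ideal_def by blast
  qed
qed

end
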